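(* Let $F$ be a 2-CNF formula that contains no semicomplete sub-multiset of clauses, and let $k\ge 0$ be an integer. If $F$ has more than $3k-2$ significant variables, then $\mathrm{sat}(F)\ge (3|F|+k)/4$.
   Context: A literal is a variable $x$ or its negation $\overline{x}$. A clause is a finite set of literals with no complementary pair; a 2-CNF formula is a finite multiset of clauses each with exactly 2 literals; $|F|$ is the number of clauses counted with multiplicity. Clause $\{p,q\}$ is written $pq$. A truth assignment with values in $\{-1,1\}$ satisfies a clause if some positive literal $x$ in it has value $1$ or some negative literal $\overline{x}$ in it has $x$ of value $-1$; $\mathrm{sat}(F)$ is the maximum over truth assignments of the variables of $F$ of the number of satisfied clauses. Two distinct clauses $Y,Z$ have a conflict if some literal $p\in Y$ has $\overline{p}\in Z$; a 2-CNF formula is semicomplete if it has exactly $4$ clauses and every pair of distinct clauses has a conflict. A variable $x$ of $F$ is insignificant if for each literal $y$ the number of occurrences of the clause $xy$ in $F$ equals the number of occurrences of the clause $\overline{x}y$ in $F$; otherwise $x$ is significant. *)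

theory Defs
  imports Complex_Main "HOL-Library.Multiset" "HOL-Library.FuncSet"
begin

datatype 'v literal = Pos (var: 'v) | Neg (var: 'v)

fun compl :: "'v literal \<Rightarrow> 'v literal" where
  "compl (Pos x) = Neg x"
| "compl (Neg x) = Pos x"

type_synonym 'v clause = "'v literal set"
type_synonym 'v formula = "'v clause multiset"

definition is_clause :: "'v clause \<Rightarrow> bool" where
  "is_clause Y \<longleftrightarrow> finite Y \<and> (\<forall>p\<in>Y. compl p \<notin> Y)"

definition two_cnf :: "'v formula \<Rightarrow> bool" where
  "two_cnf F \<longleftrightarrow> (\<forall>Y\<in>#F. is_clause Y \<and> card Y = 2)"

definition vars :: "'v formula \<Rightarrow> 'v set" where
  "vars F = (\<Union>Y\<in>set_mset F. var ` Y)"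

definition assignments :: "'v formula \<Rightarrow> ('v \<Rightarrow> int) set" where
  "assignments F = vars F \<rightarrow>\<^sub>E {-1, 1}"

definition satisfies :: "('v \<Rightarrow> int) \<Rightarrow> 'v clause \<Rightarrow> bool" where
  "satisfies \<tau> Y \<longleftrightarrow> (\<exists>x. Pos x \<in> Y \<and> \<tau> x = 1) \<or> (\<exists>x. Neg x \<in> Y \<and> \<tau> x = -1)"

definition sat :: "'v formula \<Rightarrow> nat" where
  "sat F = Max ((\<lambda>\<tau>. size (filter_mset (satisfies \<tau>) F)) ` assignments F)"

definition conflict :: "'v clause \<Rightarrow> 'v clause \<Rightarrow> bool" where
  "conflict Y Z \<longleftrightarrow> (\<exists>p\<in>Y. compl p \<in> Z)"

text \<open>
  The pairs of distinct clauses range over pairs of distinct occurrences in the multiset. As a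
  clause has no conflict with itself, the four clauses of a semicomplete formula are pairwise
  different; in particular, four copies of one clause are not semicomplete.
\<close>
definition semicomplete :: "'v formula \<Rightarrow> bool" where
  "semicomplete S \<longleftrightarrow> two_cnf S \<and> size S = 4 \<and> (\<forall>Y Z. {#Y, Z#} \<subseteq># S \<longrightarrow> conflict Y Z)"

text \<open>
  For a literal \<open>y\<close> over \<open>x\<close> itself neither set below is a clause with two literals, so in a 2-CNF
  formula both counts are 0.
\<close>
definition insignificant :: "'v formula \<Rightarrow> 'v \<Rightarrow> bool" where
  "insignificant F x \<longleftrightarrow> (\<forall>y. count F {Pos x, y} = count F {Neg x, y})"

definition significant_vars :: "'v formula \<Rightarrow> 'v set" where
  "significant_vars F = {x \<in> vars F. \<not> insignificant F x}"

end

theory Submission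
  imports Defs
begin

text \<open>
  If \<open>a\<close> and \<open>b\<close> are the \<open>\<plusminus>1\<close> values of the literals of a clause, then
  \<open>9 - (a + b - 1)\<^sup>2\<close> is \<open>8\<close> or \<open>0\<close> according to whether the clause is satisfied. With an extra vertex
  \<open>None\<close> for the constant \<open>-1\<close>, the quantity \<open>8 sat - 6 |F|\<close> becomes the maximum over \<open>\<plusminus>1\<close> vectors of
  an integer quadratic form with zero diagonal. If \<open>F\<close> has no semicomplete part, every significant
  variable \<open>x\<close> has a nonzero coefficient in this form: otherwise, for each variable \<open>y\<close>, the
  excess of the occurrences of a literal over \<open>y\<close> with \<open>x\<close> over those with its negation is the same
  for both literals, and these excesses sum to zero over all \<open>y\<close>. If they do not all vanish, a variable with positive and one with negative excess
  give a semicomplete formula.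

  For such a form without isolated vertices on a vertex set \<open>V\<close>, the maximum is at least \<open>2|V|/3\<close>:
  choose an edge \<open>uv\<close> and let \<open>W\<close> consist of the vertices that become isolated when \<open>u\<close> and \<open>v\<close>
  are removed. On \<open>{u, v} \<union> W\<close> the value \<open>2 max 1 |W|\<close> is attainable, the remaining vertices are
  handled by induction, and negating one of the two partial vectors, if necessary, makes the cross
  terms nonnegative.
\<close>

section \<open>Integer quadratic forms on sign vectors\<close>

definition quad :: "('a \<Rightarrow> 'a \<Rightarrow> int) \<Rightarrow> 'a set \<Rightarrow> ('a \<Rightarrow> int) \<Rightarrow> int" where
  "quad c V x = (\<Sum>i\<in>V. \<Sum>j\<in>V. c i j * x i * x j)"

definition sign_vector :: "('a \<Rightarrow> int) \<Rightarrow> bool" where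
  "sign_vector x \<longleftrightarrow> (\<forall>i. x i = 1 \<or> x i = -1)"

lemma quad_cong: "(\<And>i. i \<in> V \<Longrightarrow> x i = y i) \<Longrightarrow> quad c V x = quad c V y"
  unfolding quad_def by (intro sum.cong) auto

lemma quad_uminus: "quad c V (\<lambda>i. - x i) = quad c V x"
  by (simp add: quad_def)

lemma quad_Un_disjoint:
  assumes "finite A" "finite B" "A \<inter> B = {}" and sym: "\<And>i j. c i j = c j i"
  shows "quad c (A \<union> B) x = quad c A x + quad c B x + 2 * (\<Sum>i\<in>A. \<Sum>j\<in>B. c i j * x i * x j)"
proof -
  have "(\<Sum>i\<in>B. \<Sum>j\<in>A. c i j * x i * x j) = (\<Sum>i\<in>A. \<Sum>j\<in>B. c i j * x i * x j)"
    by (subst sum.swap) (simp add: sym mult_ac)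
  then show ?thesis
    using assms(1-3) by (simp add: quad_def sum.union_disjoint sum.distrib)
qed

text \<open>Negating \<open>y\<close> keeps its value on \<open>B\<close> and reverses the cross sum
  between \<open>A\<close> and \<open>B\<close>, so \<open>x\<close> glued to \<open>y\<close> or to
  its negative has a nonnegative cross sum.\<close>

lemma quad_superadditive:
  assumes "finite A" "finite B" "A \<inter> B = {}" and sym: "\<And>i j. c i j = c j i"
    and "sign_vector x" "sign_vector y"
  obtains z where "sign_vector z" "quad c A x + quad c B y \<le> quad c (A \<union> B) z"
proof -
  define z where "z s i = (if i \<in> A then x i else s * y i)" for s :: int and i
  have A: "quad c A (z s) = quad c A x" for s
    by (rule quad_cong) (simp add: z_def)
  have "quad c B (z 1) = quad c B y"
    using assms(3) by (intro quad_cong) (auto simp: z_def)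
  moreover have "quad c B (z (-1)) = quad c B (\<lambda>i. - y i)"
    using assms(3) by (intro quad_cong) (auto simp: z_def)
  ultimately have B: "quad c B (z 1) = quad c B y" "quad c B (z (-1)) = quad c B y"
    by (simp_all add: quad_uminus)
  have "(\<Sum>i\<in>A. \<Sum>j\<in>B. c i j * z (-1) i * z (-1) j) = (\<Sum>i\<in>A. \<Sum>j\<in>B. - (c i j * z 1 i * z 1 j))"
    using assms(3) by (intro sum.cong refl) (auto simp: z_def)
  then have "(\<Sum>i\<in>A. \<Sum>j\<in>B. c i j * z (-1) i * z (-1) j) = - (\<Sum>i\<in>A. \<Sum>j\<in>B. c i j * z 1 i * z 1 j)"
    by (simp add: sum_negf)
  then have "quad c A x + quad c B y \<le> quad c (A \<union> B) (z 1) \<or>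
      quad c A x + quad c B y \<le> quad c (A \<union> B) (z (-1))"
    using quad_Un_disjoint[where c = c and x = "z 1", OF assms(1-3) sym]
      quad_Un_disjoint[where c = c and x = "z (-1)", OF assms(1-3) sym] A[of 1] A[of "-1"] B
    by (intro disjCI) linarith
  moreover have "sign_vector (z 1)" "sign_vector (z (-1))"
    using assms(5,6) by (auto simp: sign_vector_def z_def)
  ultimately show thesis using that by blast
qed

text \<open>Once \<open>u\<close> and \<open>v\<close> are fixed, the vertices of \<open>W\<close>
  do not interact and can be chosen one by one. Averaging over the two signs of \<open>v\<close>
  cancels the term of the edge \<open>uv\<close>; integers \<open>a\<close>, \<open>b\<close> that
  are not both zero satisfy \<open>\<bar>a + b\<bar> + \<bar>a - b\<bar> \<ge> 2\<close>, which
  leaves \<open>2 * card W\<close>.\<close>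

lemma quad_double_star:
  assumes sym: "\<And>i j. c i j = c j i" and diag: "\<And>i. c i i = 0"
    and uv: "c u v \<noteq> 0" "u \<notin> W" "v \<notin> W" and "finite W"
    and indep: "\<And>i j. i \<in> W \<Longrightarrow> j \<in> W \<Longrightarrow> c i j = 0"
    and adj: "\<And>i. i \<in> W \<Longrightarrow> c u i \<noteq> 0 \<or> c v i \<noteq> 0"
  obtains x where "sign_vector x" "2 * max 1 (int (card W)) \<le> quad c ({u, v} \<union> W) x"
proof -
  have "u \<noteq> v" using uv diag by metis
  \<comment> \<open>Each vertex of \<open>W\<close> takes the sign of its linear coefficient and so
    contributes the absolute value of that coefficient.\<close>
  define x where "x s i = (if i = u then 1 else if i = v then s
      else if c u i + s * c v i \<ge> 0 then 1 else -1)" for s i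
  have sv: "sign_vector (x 1)" "sign_vector (x (-1))"
    by (auto simp: sign_vector_def x_def)
  have val: "quad c ({u, v} \<union> W) (x s) = 2 * s * c u v + 2 * (\<Sum>i\<in>W. \<bar>c u i + s * c v i\<bar>)" for s
  proof -
    have "quad c W (x s) = 0"
      using indep by (simp add: quad_def)
    moreover have "quad c {u, v} (x s) = 2 * s * c u v"
      using \<open>u \<noteq> v\<close> sym[of v u] by (simp add: quad_def x_def diag)
    moreover have "(\<Sum>i\<in>{u, v}. \<Sum>j\<in>W. c i j * x s i * x s j) = (\<Sum>j\<in>W. \<bar>c u j + s * c v j\<bar>)"
    proof -
      have "(\<Sum>i\<in>{u, v}. \<Sum>j\<in>W. c i j * x s i * x s j)
          = (\<Sum>j\<in>W. c u j * x s u * x s j + c v j * x s v * x s j)"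
        using \<open>u \<noteq> v\<close> by (simp add: sum.distrib)
      also have "\<dots> = (\<Sum>j\<in>W. \<bar>c u j + s * c v j\<bar>)"
        using uv \<open>u \<noteq> v\<close> by (intro sum.cong refl) (auto simp: x_def algebra_simps)
      finally show ?thesis .
    qed
    ultimately show ?thesis
      using quad_Un_disjoint[of "{u, v}" W c "x s"] \<open>finite W\<close> uv sym by simp
  qed
  have val1: "quad c ({u, v} \<union> W) (x 1) = 2 * c u v + 2 * (\<Sum>i\<in>W. \<bar>c u i + c v i\<bar>)"
    and val2: "quad c ({u, v} \<union> W) (x (-1)) = - 2 * c u v + 2 * (\<Sum>i\<in>W. \<bar>c u i - c v i\<bar>)"
    using val[of 1] val[of "-1"] by simp_all
  \<comment> \<open>averaging over the sign of \<open>v\<close>\<close>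
  have "2 * int (card W) = (\<Sum>i\<in>W. 2)" by simp
  also have "\<dots> \<le> (\<Sum>i\<in>W. \<bar>c u i + c v i\<bar> + \<bar>c u i - c v i\<bar>)"
    using adj by (intro sum_mono) (smt (verit))
  finally have avg: "2 * int (card W) \<le> (\<Sum>i\<in>W. \<bar>c u i + c v i\<bar>) + (\<Sum>i\<in>W. \<bar>c u i - c v i\<bar>)"
    by (simp add: sum.distrib)
  have nonneg: "0 \<le> (\<Sum>i\<in>W. \<bar>c u i + c v i\<bar>)" "0 \<le> (\<Sum>i\<in>W. \<bar>c u i - c v i\<bar>)"
    by (simp_all add: sum_nonneg)
  have "2 * max 1 (int (card W)) \<le> quad c ({u, v} \<union> W) (x 1) \<or>
      2 * max 1 (int (card W)) \<le> quad c ({u, v} \<union> W) (x (-1))"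
  proof (cases "card W = 0")
    case True
    then have "max 1 (int (card W)) = 1" by simp
    \<comment> \<open>Here \<open>s\<close> is the sign of \<open>c u v\<close>, and integrality
      gives \<open>\<bar>c u v\<bar> \<ge> 1\<close>.\<close>
    then show ?thesis using val1 val2 nonneg uv(1) by (intro disjCI) linarith
  next
    case False
    then have "max 1 (int (card W)) = int (card W)" by simp
    then show ?thesis using val1 val2 avg by (intro disjCI) linarith
  qed
  then show thesis using that sv by blast
qed

lemma quad_ge_card:
  assumes "finite V" and sym: "\<And>i j. c i j = c j i" and diag: "\<And>i. c i i = 0"
    and "\<And>i. i \<in> V \<Longrightarrow> \<exists>j\<in>V. c i j \<noteq> 0"
  shows "\<exists>x. sign_vector x \<and> 2 * int (card V) \<le> 3 * quad c V x"
  using assms(1,4)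
proof (induction V rule: finite_psubset_induct)
  case (psubset V)
  show ?case
  proof (cases "V = {}")
    case True
    then show ?thesis by (intro exI[of _ "\<lambda>_. 1"]) (simp add: quad_def sign_vector_def)
  next
    case False
    then obtain u v where uv: "u \<in> V" "v \<in> V" "c u v \<noteq> 0" using psubset.prems by blast
    define W where "W = {i \<in> V - {u, v}. \<forall>j\<in>V - {u, v}. c i j = 0}"
    define R where "R = V - ({u, v} \<union> W)"
    have "finite W" "finite R" using psubset.hyps by (auto simp: W_def R_def)
    have V: "V = ({u, v} \<union> W) \<union> R" and disj: "({u, v} \<union> W) \<inter> R = {}"
      using uv by (auto simp: W_def R_def)
    \<comment> \<open>A neighbour of \<open>i\<close> outside \<open>{u, v}\<close> cannot lie in
      \<open>W\<close>, whose members have all their neighbours in \<open>{u, v}\<close>. Hence the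
      induction hypothesis applies to \<open>R\<close>.\<close>
    have "\<exists>j\<in>R. c i j \<noteq> 0" if "i \<in> R" for i
    proof -
      obtain j where j: "j \<in> V - {u, v}" "c i j \<noteq> 0" using \<open>i \<in> R\<close> by (auto simp: R_def W_def)
      have "j \<notin> W" using j(2) \<open>i \<in> R\<close> sym[of i j] by (auto simp: R_def W_def)
      then show ?thesis using j by (auto simp: R_def)
    qed
    moreover have "R \<subset> V" using uv by (auto simp: R_def)
    ultimately obtain y where y: "sign_vector y" "2 * int (card R) \<le> 3 * quad c R y"
      using psubset.IH by blast
    have adj: "c u i \<noteq> 0 \<or> c v i \<noteq> 0" if "i \<in> W" for i
    proof -
      obtain j where "j \<in> V" "c i j \<noteq> 0" using psubset.prems \<open>i \<in> W\<close> by (auto simp: W_def)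
      then have "j = u \<or> j = v" using \<open>i \<in> W\<close> by (auto simp: W_def)
      then show ?thesis using \<open>c i j \<noteq> 0\<close> sym[of i j] by auto
    qed
    obtain x where x: "sign_vector x" "2 * max 1 (int (card W)) \<le> quad c ({u, v} \<union> W) x"
      by (rule quad_double_star[where c = c and W = W, OF sym diag uv(3)])
        (use \<open>finite W\<close> adj in \<open>auto simp: W_def\<close>)
    obtain z where z: "sign_vector z" "quad c ({u, v} \<union> W) x + quad c R y \<le> quad c V z"
      using quad_superadditive[where c = c, OF _ \<open>finite R\<close> disj sym x(1) y(1)] \<open>finite W\<close> V by auto
    have "card V \<le> card {u, v} + card W + card R"
      unfolding V by (meson add_le_mono1 card_Un_le le_trans)
    also have "card {u, v} \<le> 2" by (simp add: card_insert_if)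
    finally have "int (card V) \<le> 2 + int (card W) + int (card R)" by simp
    \<comment> \<open>The factor 3 comes from \<open>2 * (2 + w) \<le> 6 * max 1 w\<close> for
      \<open>w = card W\<close>, with equality at \<open>w = 1\<close>.\<close>
    then have "2 * int (card V) \<le> 3 * quad c V z" using x(2) y(2) z(2) by linarith
    then show ?thesis using z(1) by blast
  qed
qed

text \<open>Deleting isolated vertices does not change the value of the form, and it isolates no
  further vertex because a neighbour is never isolated.\<close>

lemma quad_ge_card_nonisolated:
  assumes "finite V" and sym: "\<And>i j. c i j = c j i" and diag: "\<And>i. c i i = 0"
  shows "\<exists>x. sign_vector x \<and> 2 * int (card {i \<in> V. \<exists>j\<in>V. c i j \<noteq> 0}) \<le> 3 * quad c V x"
proof -
  define U where "U = {i \<in> V. \<exists>j\<in>V. c i j \<noteq> 0}"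
  have "finite U" "U \<subseteq> V" using assms(1) by (auto simp: U_def)
  have "\<exists>j\<in>U. c i j \<noteq> 0" if "i \<in> U" for i
    using that sym by (fastforce simp: U_def)
  then obtain x where x: "sign_vector x" "2 * int (card U) \<le> 3 * quad c U x"
    using quad_ge_card[where c = c, OF \<open>finite U\<close> sym diag] by blast
  have zero: "c i j = 0" if "i \<in> V" "j \<in> V" "i \<notin> U \<or> j \<notin> U" for i j
    using that sym[of i j] by (auto simp: U_def)
  have "quad c U x = (\<Sum>i\<in>U. \<Sum>j\<in>V. c i j * x i * x j)"
    unfolding quad_def
    by (intro sum.cong refl sum.mono_neutral_left) (use assms(1) \<open>U \<subseteq> V\<close> zero in auto)
  also have "\<dots> = quad c V x"
    unfolding quad_def
    by (intro sum.mono_neutral_left) (use assms(1) \<open>U \<subseteq> V\<close> zero in auto)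
  finally show ?thesis using x unfolding U_def by auto
qed

section \<open>The quadratic form of a 2-CNF formula\<close>

text \<open>The entry -1 at \<open>None\<close> makes the inner product with a sign vector
  \<open>x\<close> with \<open>x None = 1\<close> equal to \<open>a + b - 1\<close>, for
  \<open>a\<close> and \<open>b\<close> the values of the two literals.\<close>

fun literal_sign :: "'v clause \<Rightarrow> 'v option \<Rightarrow> int" where
  "literal_sign Y None = -1"
| "literal_sign Y (Some x) = of_bool (Pos x \<in> Y) - of_bool (Neg x \<in> Y)"

text \<open>The negated Gram matrix of the literal signs; its diagonal is erased since it adds only
  a constant on sign vectors.\<close>

definition coeff :: "'v formula \<Rightarrow> 'v option \<Rightarrow> 'v option \<Rightarrow> int" where
  "coeff F i j = (if i = j then 0 else - (\<Sum>Y\<in>#F. literal_sign Y i * literal_sign Y j))"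

definition opt_vars :: "'v formula \<Rightarrow> 'v option set" where
  "opt_vars F = insert None (Some ` vars F)"

lemma two_clauseE:
  assumes "is_clause Y" "card Y = 2"
  obtains p q where "Y = {p, q}" "var p \<noteq> var q"
proof -
  obtain p q where pq: "Y = {p, q}" "p \<noteq> q" using assms(2) by (auto simp: card_2_iff)
  then have "compl p \<noteq> q" using assms(1) by (auto simp: is_clause_def)
  then have "var p \<noteq> var q" using \<open>p \<noteq> q\<close> by (cases p; cases q) auto
  then show thesis using that pq by blast
qed

lemma finite_vars: "two_cnf F \<Longrightarrow> finite (vars F)"
  by (auto simp: vars_def two_cnf_def is_clause_def)

lemma two_cnf_clauseD: "two_cnf F \<Longrightarrow> Y \<in># F \<Longrightarrow> is_clause Y \<and> card Y = 2"
  by (simp add: two_cnf_def)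

lemma sum_sum_mset_swap:
  fixes f :: "'a \<Rightarrow> 'b \<Rightarrow> 'c::comm_monoid_add"
  shows "(\<Sum>i\<in>A. \<Sum>Y\<in>#F. f i Y) = (\<Sum>Y\<in>#F. \<Sum>i\<in>A. f i Y)"
  by (induction F) (simp_all add: sum.distrib)

lemma sum_two_clause:
  fixes g :: "'v option \<Rightarrow> int"
  assumes "finite V" "is_clause Y" "card Y = 2" "var ` Y \<subseteq> V"
    and g: "\<And>x. x \<notin> var ` Y \<Longrightarrow> g (Some x) = 0"
  shows "(\<Sum>i\<in>insert None (Some ` V). g i) = g None + (\<Sum>p\<in>Y. g (Some (var p)))"
proof -
  obtain p q where Y: "Y = {p, q}" "var p \<noteq> var q" using two_clauseE assms(2,3) by blast
  have "(\<Sum>i\<in>insert None (Some ` V). g i) = g None + (\<Sum>x\<in>V. g (Some x))"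
    using \<open>finite V\<close> by (simp add: sum.reindex image_iff)
  also have "(\<Sum>x\<in>V. g (Some x)) = (\<Sum>x\<in>{var p, var q}. g (Some x))"
    using assms(1,4) g Y(1) by (intro sum.mono_neutral_right) auto
  also have "\<dots> = (\<Sum>p\<in>Y. g (Some (var p)))"
    using Y by (cases "p = q") simp_all
  finally show ?thesis .
qed

text \<open>The three nonzero entries have squares summing to 3. The inner product is -3 for an
  unsatisfied clause and 1 or -1 otherwise, so the difference is -6 or 2.\<close>

lemma literal_sign_square_identity:
  assumes "finite V" "is_clause Y" "card Y = 2" "var ` Y \<subseteq> V"
    and sv: "sign_vector x" and "x None = 1"
  shows "(\<Sum>i\<in>insert None (Some ` V). (literal_sign Y i)\<^sup>2)
      - (\<Sum>i\<in>insert None (Some ` V). literal_sign Y i * x i)\<^sup>2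
    = 8 * of_bool (satisfies (\<lambda>v. x (Some v)) Y) - 6"
proof -
  obtain p q where Y: "Y = {p, q}" "var p \<noteq> var q" using two_clauseE assms(2,3) by blast
  have pq: "p \<noteq> q" using Y by auto
  have zero: "literal_sign Y (Some v) = 0" if "v \<notin> var ` Y" for v
    using that by (force simp: image_iff)
  have "(\<Sum>i\<in>insert None (Some ` V). (literal_sign Y i)\<^sup>2) = 3"
    using sum_two_clause[OF assms(1-4), of "\<lambda>i. (literal_sign Y i)\<^sup>2"] zero Y
    by (cases p; cases q) auto
  moreover have "(\<Sum>i\<in>insert None (Some ` V). literal_sign Y i * x i)
      = -1 + literal_sign Y (Some (var p)) * x (Some (var p))
        + literal_sign Y (Some (var q)) * x (Some (var q))"
    using sum_two_clause[OF assms(1-4), of "\<lambda>i. literal_sign Y i * x i"] zero \<open>x None = 1\<close> pq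
    by (simp add: Y(1) del: literal_sign.simps(2))
  moreover have "x (Some (var p)) = 1 \<or> x (Some (var p)) = -1"
    "x (Some (var q)) = 1 \<or> x (Some (var q)) = -1"
    using sv by (auto simp: sign_vector_def)
  ultimately show ?thesis
    using Y by (cases p; cases q) (auto simp: satisfies_def)
qed

lemma quad_coeff_eq:
  assumes "two_cnf F" and sv: "sign_vector x" and "x None = 1"
  shows "quad (coeff F) (opt_vars F) x
    = 8 * int (size (filter_mset (satisfies (\<lambda>v. x (Some v))) F)) - 6 * int (size F)"
proof -
  let ?V = "opt_vars F" and ?s = literal_sign
  have "finite ?V" using finite_vars[OF assms(1)] by (simp add: opt_vars_def)
  have sq: "x i * x i = 1" for i
    using sv by (auto simp: sign_vector_def dest: spec[of _ i])
  \<comment> \<open>For \<open>i = j\<close> the two terms cancel, matching the zero diagonal; in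
    this form the double sum splits clause by clause into the square identity.\<close>
  have "coeff F i j * x i * x j
      = (\<Sum>Y\<in>#F. (if i = j then (?s Y i)\<^sup>2 else 0) - (?s Y i * x i) * (?s Y j * x j))" for i j
  proof (cases "i = j")
    case True
    have "(?s Y j)\<^sup>2 - ?s Y j * x j * (?s Y j * x j) = 0" for Y
      using sq[of j] by (simp add: power2_eq_square algebra_simps)
    then show ?thesis using True by (simp add: coeff_def)
  next
    case False
    then show ?thesis
      by (induction F) (auto simp: coeff_def algebra_simps)
  qed
  then have "quad (coeff F) ?V x = (\<Sum>Y\<in>#F. \<Sum>i\<in>?V. \<Sum>j\<in>?V.
      (if i = j then (?s Y i)\<^sup>2 else 0) - (?s Y i * x i) * (?s Y j * x j))"
    by (simp add: quad_def sum_sum_mset_swap)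
  also have "\<dots> = (\<Sum>Y\<in>#F. (\<Sum>i\<in>?V. (?s Y i)\<^sup>2) - (\<Sum>i\<in>?V. ?s Y i * x i)\<^sup>2)"
    using \<open>finite ?V\<close> by (simp add: sum_subtractf power2_eq_square sum_product)
  also have "\<dots> = (\<Sum>Y\<in>#F. 8 * of_bool (satisfies (\<lambda>v. x (Some v)) Y) - 6)"
  proof (intro arg_cong[where f = sum_mset] image_mset_cong)
    fix Y assume "Y \<in># F"
    then have "var ` Y \<subseteq> vars F" by (auto simp: vars_def)
    then show "(\<Sum>i\<in>?V. (?s Y i)\<^sup>2) - (\<Sum>i\<in>?V. ?s Y i * x i)\<^sup>2
        = 8 * of_bool (satisfies (\<lambda>v. x (Some v)) Y) - 6"
      unfolding opt_vars_def
      using literal_sign_square_identity[OF finite_vars[OF assms(1)] _ _ _ sv assms(3)]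
        two_cnf_clauseD[OF assms(1) \<open>Y \<in># F\<close>] by blast
  qed
  also have "\<dots> = 8 * int (size (filter_mset (satisfies (\<lambda>v. x (Some v))) F)) - 6 * int (size F)"
    by (induction F) auto
  finally show ?thesis .
qed

text \<open>The members of \<open>assignments F\<close> are extensional, so \<open>\<tau>\<close> is
  first restricted to \<open>vars F\<close>, which affects no clause of \<open>F\<close>.\<close>

lemma size_satisfied_le_sat:
  assumes "two_cnf F" "\<And>v. \<tau> v = 1 \<or> \<tau> v = -1"
  shows "size (filter_mset (satisfies \<tau>) F) \<le> sat F"
proof -
  let ?\<sigma> = "restrict \<tau> (vars F)"
  have "?\<sigma> \<in> assignments F" using assms(2) by (force simp: assignments_def)
  moreover have "finite (assignments F)"
    unfolding assignments_def using finite_vars[OF assms(1)] by (intro finite_PiE) auto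
  moreover have "filter_mset (satisfies \<tau>) F = filter_mset (satisfies ?\<sigma>) F"
  proof (rule filter_mset_cong[OF refl])
    fix Y assume "Y \<in># F"
    then have "x \<in> vars F" if "Pos x \<in> Y \<or> Neg x \<in> Y" for x
      using that by (force simp: vars_def)
    then show "satisfies \<tau> Y = satisfies ?\<sigma> Y" by (auto simp: satisfies_def)
  qed
  ultimately show ?thesis unfolding sat_def by (intro Max_ge) auto
qed

section \<open>Significant variables\<close>

lemma count_eq_sum_mset: "int (count F A) = (\<Sum>Y\<in>#F. of_bool (Y = A))"
  by (induction F) auto

lemma two_clause_eq_iff:
  assumes "card Y = 2" "p \<noteq> q"
  shows "Y = {p, q} \<longleftrightarrow> p \<in> Y \<and> q \<in> Y"
  using assms by (auto simp: card_2_iff)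

definition pos_excess :: "'v formula \<Rightarrow> 'v \<Rightarrow> 'v literal \<Rightarrow> int" where
  "pos_excess F x p = int (count F {Pos x, p}) - int (count F {Neg x, p})"

lemma insignificant_iff: "insignificant F x \<longleftrightarrow> (\<forall>p. pos_excess F x p = 0)"
  by (simp add: insignificant_def pos_excess_def)

text \<open>As \<open>p\<close> is not over \<open>x\<close>, both \<open>{Pos x, p}\<close> and
  \<open>{Neg x, p}\<close> have two elements, so a clause equals one of them exactly when it
  contains both literals.\<close>

lemma pos_excess_eq_sum_mset:
  assumes "two_cnf F" "var p \<noteq> x"
  shows "pos_excess F x p = (\<Sum>Y\<in>#F. literal_sign Y (Some x) * of_bool (p \<in> Y))"
proof -
  have "pos_excess F x p = (\<Sum>Y\<in>#F. of_bool (Y = {Pos x, p}) - of_bool (Y = {Neg x, p}))"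
    by (simp only: pos_excess_def count_eq_sum_mset sum_mset_diff[symmetric])
      (induction F; simp)
  also have "\<dots> = (\<Sum>Y\<in>#F. literal_sign Y (Some x) * of_bool (p \<in> Y))"
  proof (intro arg_cong[where f = sum_mset] image_mset_cong)
    fix Y assume "Y \<in># F"
    then have "card Y = 2" using two_cnf_clauseD[OF assms(1)] by blast
    moreover have "Pos x \<noteq> p" "Neg x \<noteq> p" using assms(2) by auto
    ultimately show "of_bool (Y = {Pos x, p}) - of_bool (Y = {Neg x, p})
        = literal_sign Y (Some x) * of_bool (p \<in> Y)"
      by (simp add: two_clause_eq_iff)
  qed
  finally show ?thesis .
qed

lemma pos_excess_eq_0:
  assumes "two_cnf F" "var p = x \<or> var p \<notin> vars F"
  shows "pos_excess F x p = 0"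
proof -
  have "{l, p} \<notin># F" if "var l = x" for l
  proof
    assume l: "{l, p} \<in># F"
    then obtain a b where ab: "{l, p} = {a, b}" "var a \<noteq> var b"
      using two_clauseE two_cnf_clauseD[OF assms(1)] by metis
    then have "var p \<noteq> x" using that by (auto simp: doubleton_eq_iff)
    moreover have "var p \<in> vars F" using l unfolding vars_def by blast
    ultimately show False using assms(2) by blast
  qed
  then show ?thesis by (simp add: pos_excess_def not_in_iff)
qed

lemma coeff_Some_eq:
  assumes "two_cnf F" "x \<noteq> y"
  shows "coeff F (Some x) (Some y) = pos_excess F x (Neg y) - pos_excess F x (Pos y)"
proof -
  have "pos_excess F x (Neg y) - pos_excess F x (Pos y)
      = (\<Sum>Y\<in>#F. literal_sign Y (Some x) * of_bool (Neg y \<in> Y))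
        - (\<Sum>Y\<in>#F. literal_sign Y (Some x) * of_bool (Pos y \<in> Y))"
    using assms by (simp add: pos_excess_eq_sum_mset del: literal_sign.simps)
  also have "\<dots> = - (\<Sum>Y\<in>#F. literal_sign Y (Some x) * literal_sign Y (Some y))"
    by (induction F) (simp_all add: algebra_simps)
  finally show ?thesis using assms(2) by (simp add: coeff_def)
qed

text \<open>A clause containing \<open>x\<close> has exactly one other literal, so the sum over the
  literals of other variables counts it once, with the sign of \<open>x\<close>. The entry -1 at
  \<open>None\<close> cancels the minus sign in \<open>coeff\<close>.\<close>

lemma coeff_None_eq:
  assumes "two_cnf F"
  shows "coeff F (Some x) None = (\<Sum>y\<in>vars F - {x}. pos_excess F x (Pos y) + pos_excess F x (Neg y))"
proof -
  let ?s = literal_sign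
  have "(\<Sum>y\<in>vars F - {x}. pos_excess F x (Pos y) + pos_excess F x (Neg y))
      = (\<Sum>y\<in>vars F - {x}. \<Sum>Y\<in>#F. ?s Y (Some x) * (of_bool (Pos y \<in> Y) + of_bool (Neg y \<in> Y)))"
    by (intro sum.cong refl)
      (simp add: pos_excess_eq_sum_mset[OF assms] sum_mset.distrib distrib_left del: literal_sign.simps)
  also have "\<dots> = (\<Sum>Y\<in>#F. \<Sum>y\<in>vars F - {x}. ?s Y (Some x) * (of_bool (Pos y \<in> Y) + of_bool (Neg y \<in> Y)))"
    by (rule sum_sum_mset_swap)
  also have "\<dots> = (\<Sum>Y\<in>#F. ?s Y (Some x))"
  proof (intro arg_cong[where f = sum_mset] image_mset_cong)
    fix Y assume "Y \<in># F"
    obtain p q where Y: "Y = {p, q}" "var p \<noteq> var q"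
      using two_clauseE two_cnf_clauseD[OF assms \<open>Y \<in># F\<close>] by blast
    have sub: "var p \<in> vars F" "var q \<in> vars F"
      using \<open>Y \<in># F\<close> Y unfolding vars_def by blast+
    have other: "(\<Sum>y\<in>vars F - {x}. of_bool (Pos y \<in> Y) + of_bool (Neg y \<in> Y)) = (1::int)"
      if "x \<in> var ` Y"
    proof -
      have "\<exists>r\<in>Y. var r \<noteq> x \<and> (\<forall>l\<in>Y. var l \<noteq> x \<longrightarrow> l = r)"
        using that Y by (cases "var p = x") auto
      then obtain r where r: "r \<in> Y" "var r \<noteq> x" "\<And>l. l \<in> Y \<Longrightarrow> var l \<noteq> x \<Longrightarrow> l = r"
        by blast
      have "var r \<in> vars F" using r(1) Y(1) sub by auto
      have "of_bool (Pos y \<in> Y) + of_bool (Neg y \<in> Y) = (if y = var r then 1 else (0::int))"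
        if "y \<noteq> x" for y
      proof -
        have "Pos y \<in> Y \<longleftrightarrow> r = Pos y" "Neg y \<in> Y \<longleftrightarrow> r = Neg y"
          using r(1) r(3)[of "Pos y"] r(3)[of "Neg y"] that by auto
        then show ?thesis by (cases r) auto
      qed
      then have "(\<Sum>y\<in>vars F - {x}. of_bool (Pos y \<in> Y) + of_bool (Neg y \<in> Y))
          = (\<Sum>y\<in>vars F - {x}. if y = var r then 1 else (0::int))"
        by (intro sum.cong refl) blast
      then show ?thesis using r(2) \<open>var r \<in> vars F\<close> finite_vars[OF assms] by simp
    qed
    show "(\<Sum>y\<in>vars F - {x}. ?s Y (Some x) * (of_bool (Pos y \<in> Y) + of_bool (Neg y \<in> Y)))
        = ?s Y (Some x)"
    proof (cases "x \<in> var ` Y")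
      case True
      then show ?thesis using other by (simp add: sum_distrib_left[symmetric] del: literal_sign.simps)
    next
      case False
      then have "?s Y (Some x) = 0" by (force simp: image_iff)
      then show ?thesis by (simp del: literal_sign.simps)
    qed
  qed
  also have "\<dots> = coeff F (Some x) None"
    by (simp add: coeff_def sum_mset.neutral del: literal_sign.simps(2))
      (induction F; simp)
  finally show ?thesis by simp
qed

text \<open>Clauses sharing a literal over \<open>x\<close> conflict in \<open>y\<close> or in
  \<open>z\<close>, all other pairs in \<open>x\<close>; the case \<open>y = z\<close> is
  included.\<close>

lemma semicomplete_around:
  assumes "x \<noteq> y" "x \<noteq> z"
  shows "semicomplete {#{Pos x, Pos y}, {Pos x, Neg y}, {Neg x, Pos z}, {Neg x, Neg z}#}"
    (is "semicomplete ?S")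
proof -
  have "two_cnf ?S" using assms by (auto simp: two_cnf_def is_clause_def)
  moreover have "conflict Y Z" if "{#Y, Z#} \<subseteq># ?S" for Y Z
    using that assms
    by (auto simp: insert_subset_eq_iff conflict_def doubleton_eq_iff split: if_splits)
  ultimately show ?thesis by (simp add: semicomplete_def)
qed

lemma exists_coeff_neq_0:
  assumes F: "two_cnf F" and nosemi: "\<not> (\<exists>S. S \<subseteq># F \<and> semicomplete S)"
    and x: "x \<in> significant_vars F"
  shows "\<exists>j\<in>opt_vars F. coeff F (Some x) j \<noteq> 0"
proof (rule ccontr)
  assume "\<not> ?thesis"
  then have zero: "coeff F (Some x) None = 0"
    "\<And>y. y \<in> vars F \<Longrightarrow> coeff F (Some x) (Some y) = 0"
    by (auto simp: opt_vars_def)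
  let ?e = "\<lambda>y. pos_excess F x (Pos y)"
  \<comment> \<open>For \<open>y = x\<close> or \<open>y\<close> outside \<open>vars F\<close> both
    sides are 0; otherwise the vanishing coefficient at \<open>y\<close> equates them.\<close>
  have eq: "pos_excess F x (Neg y) = ?e y" for y
    using zero(2)[of y] coeff_Some_eq[OF F, of x y] pos_excess_eq_0[OF F, of _ x]
    by (cases "y \<in> vars F \<and> x \<noteq> y") auto
  have "2 * (\<Sum>y\<in>vars F - {x}. ?e y) = 0"
    using zero(1) coeff_None_eq[OF F, of x] by (simp add: eq sum_distrib_left)
  then have sum0: "(\<Sum>y\<in>vars F - {x}. ?e y) = 0" by simp
  have fin: "finite (vars F - {x})" using finite_vars[OF F] by simp
  obtain p where "pos_excess F x p \<noteq> 0"
    using x by (auto simp: significant_vars_def insignificant_iff)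
  then have p: "?e (var p) \<noteq> 0" "var p \<in> vars F - {x}"
    using eq pos_excess_eq_0[OF F, of p x] by (cases p; auto)+
  \<comment> \<open>Since the excess at \<open>var p\<close> is nonzero, a sum without positive
    terms would be strictly negative.\<close>
  have "\<exists>y\<in>vars F - {x}. ?e y > 0"
  proof (rule ccontr)
    assume "\<not> ?thesis"
    then have "(\<Sum>y\<in>vars F - {x}. ?e y) < (\<Sum>y\<in>vars F - {x}. 0)"
      using p by (intro sum_strict_mono_ex1 fin) force+
    then show False using sum0 by simp
  qed
  then obtain y where y: "y \<in> vars F - {x}" "?e y > 0" by blast
  have "\<exists>z\<in>vars F - {x}. ?e z < 0"
  proof (rule ccontr)
    assume "\<not> ?thesis"
    then have "(\<Sum>y\<in>vars F - {x}. 0) < (\<Sum>y\<in>vars F - {x}. ?e y)"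
      using p by (intro sum_strict_mono_ex1 fin) force+
    then show False using sum0 by simp
  qed
  then obtain z where z: "z \<in> vars F - {x}" "?e z < 0" by blast
  have "{Pos x, Pos y} \<in># F" "{Pos x, Neg y} \<in># F" "{Neg x, Pos z} \<in># F" "{Neg x, Neg z} \<in># F"
    using y z eq[of y] eq[of z] by (auto simp: pos_excess_def count_greater_zero_iff[symmetric]
        simp del: count_greater_zero_iff)
  \<comment> \<open>The four clauses are pairwise different, so one occurrence of each
    suffices.\<close>
  then have "{#{Pos x, Pos y}, {Pos x, Neg y}, {Neg x, Pos z}, {Neg x, Neg z}#} \<subseteq># F"
    using y z by (auto simp: subseteq_mset_def doubleton_eq_iff Suc_le_eq)
  then show False using nosemi semicomplete_around[of x y z] y z by blast
qed

theorem theorem5p3: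
  fixes F :: "'v formula" and k :: int
  assumes "two_cnf F"
    and "\<not> (\<exists>S. S \<subseteq># F \<and> semicomplete S)"
    and "k \<ge> 0"
    and "int (card (significant_vars F)) > 3 * k - 2"
  shows "real (sat F) \<ge> (3 * real (size F) + real_of_int k) / 4"
proof -
  let ?V = "opt_vars F" and ?c = "coeff F"
  let ?U = "{i \<in> ?V. \<exists>j\<in>?V. ?c i j \<noteq> 0}"
  have fin: "finite ?V" using finite_vars[OF assms(1)] by (simp add: opt_vars_def)
  have "?c i j = ?c j i" "?c i i = 0" for i j by (simp_all add: coeff_def mult.commute)
  then obtain x where x: "sign_vector x" "2 * int (card ?U) \<le> 3 * quad ?c ?V x"
    using quad_ge_card_nonisolated[where c = ?c, OF fin] by blast
  \<comment> \<open>A global sign change does not affect the form, so the constant vertex can be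
    normalised to 1.\<close>
  define y where "y i = x None * x i" for i
  have "y = x \<and> x None = 1 \<or> y = (\<lambda>i. - x i) \<and> x None = -1"
    using x(1) by (cases "x None = 1") (auto simp: sign_vector_def y_def fun_eq_iff)
  then have y: "sign_vector y" "y None = 1" "quad ?c ?V y = quad ?c ?V x"
    using x(1) by (auto simp: sign_vector_def quad_uminus minus_equation_iff)
  have "Some ` significant_vars F \<subseteq> ?U"
    using exists_coeff_neq_0[OF assms(1,2)] by (auto simp: opt_vars_def significant_vars_def)
  then have "card (Some ` significant_vars F) \<le> card ?U"
    using fin by (intro card_mono) auto
  then have "card (significant_vars F) \<le> card ?U" by (simp add: card_image)
  moreover have "size (filter_mset (satisfies (\<lambda>v. y (Some v))) F) \<le> sat F"
    using y(1) by (intro size_satisfied_le_sat[OF assms(1)]) (simp add: sign_vector_def)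
  \<comment> \<open>At least \<open>3 * k - 1\<close> significant variables give a form value
    \<open>q\<close> with \<open>3 * q \<ge> 6 * k - 2\<close>; as \<open>q\<close> is an integer,
    \<open>q \<ge> 2 * k\<close>.\<close>
  ultimately have "3 * int (size F) + k \<le> 4 * int (sat F)"
    using quad_coeff_eq[OF assms(1) y(1,2)] y(3) x(2) assms(4) by linarith
  then have "real_of_int (3 * int (size F) + k) \<le> real_of_int (4 * int (sat F))"
    by (simp only: of_int_le_iff)
  then show ?thesis by simp
qed

end
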